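(* Let $u=(1,2,\ldots,n)$. Let $m$ be a positive integer with $n-m\ge4$, and let $\{x_{j_3},\ldots,x_{j_m}\}$ be any set of $m-2$ distinct variables in $\{x_{m+1},\ldots,x_n\}$. Then the following inequalities are facet-defining for $H_n(u)$: (1) $\displaystyle x_{m-1}+x_m+\sum_{i=3}^m x_{j_i}\ge\tfrac12m(m+1)$, if $4\le m\le\lceil(n+1)/2\rceil$; (2) $\displaystyle 2x_{m-1}+x_m+2\sum_{i=3}^m x_{j_i}\ge m^2+1$, if $4\le m\le\lceil(n+1)/2\rceil$; (3) $\displaystyle 2x_{m-1}+x_m+4\sum_{i=3}^m x_{j_i}\ge m(2m-3)+5$, if $3\le m\le\lceil(n+1)/2\rceil$; (4) $\displaystyle 3x_{m-1}+2x_m+4\sum_{i=3}^m x_{j_i}\ge m(2m-1)+4$, if $3\le m\le\lceil(n+1)/2\rceil$; (5) $\displaystyle 3x_{m-1}+2x_m+5\sum_{i=3}^m x_{j_i}\ge\tfrac52m(m-1)+6$, if $3\le m\le\lceil(n+1)/2\rceil$.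
   Context: A point $x=(x_1,\ldots,x_n)\in\{1,\ldots,n\}^n$ is a circuit if the map $i\mapsto x_i$ is a permutation of $\{1,\ldots,n\}$ consisting of a single $n$-cycle. For $u=(1,\ldots,n)$, the hamiltonian circuit polytope $H_n(u)\subset\mathbb{R}^n$ is the convex hull of all circuits. An inequality is facet-defining for $H_n(u)$ if it is satisfied by all points of $H_n(u)$ and the set of points of $H_n(u)$ satisfying it at equality is a face of dimension $\dim H_n(u)-1$. *)

theory Defs
  imports "HOL-Analysis.Analysis" "HOL-Combinatorics.Permutations" "HOL-Combinatorics.Orbits"
begin

text \<open>
  The space \<open>\<real>\<^sup>n\<close> is \<^typ>\<open>real ^ 'n\<close> with \<open>n = CARD('n)\<close>. The index type carries no order, so
  the numbering of the coordinates is a parameter \<open>e\<close>, to be used with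
  \<open>bij_betw e {1..CARD('n)} UNIV\<close>: the coordinate \<open>x\<^sub>i\<close> of \<open>x\<close> is \<open>x $ e i\<close>.
\<close>

text \<open>
  The map \<open>i \<mapsto> x\<^sub>i\<close> on \<open>{1..n}\<close> is represented by its extension \<open>p\<close> to \<^typ>\<open>nat\<close> that is the
  identity elsewhere. For \<open>p permutes {1..n}\<close>, \<open>cyclic_on p {1..n}\<close> says that \<open>{1..n}\<close> is one
  orbit, that is, that \<open>p\<close> is a single \<open>n\<close>-cycle.
\<close>
definition circuits :: "(nat \<Rightarrow> 'n::finite) \<Rightarrow> (real ^ 'n) set" where
  "circuits e = {x. \<exists>p. p permutes {1..CARD('n)} \<and> cyclic_on p {1..CARD('n)} \<and>
                       (\<forall>i\<in>{1..CARD('n)}. x $ e i = real (p i))}"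

definition circuit_polytope :: "(nat \<Rightarrow> 'n::finite) \<Rightarrow> (real ^ 'n) set" where
  "circuit_polytope e = convex hull (circuits e)"

text \<open>The linear inequality \<open>f x \<ge> b\<close> is facet-defining for \<open>P\<close>.\<close>
definition facet_defining :: "'a::euclidean_space set \<Rightarrow> ('a \<Rightarrow> real) \<Rightarrow> real \<Rightarrow> bool" where
  "facet_defining P f b \<longleftrightarrow>
     linear f \<and> (\<forall>x\<in>P. f x \<ge> b) \<and> {x \<in> P. f x = b} facet_of P"

end

theory Submission
  imports Defs "HOL-Combinatorics.Cycles"
begin

text \<open>
  Let \<open>S = {m-1, m} \<union> J\<close> be the support of the inequality. It has \<open>m\<close> elements, so at least four
  coordinates lie outside of it.

  An injective assignment of values to the coordinates in \<open>S\<close> whose arcs \<open>i \<mapsto> x\<^sub>i\<close> close no cycle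
  extends to a circuit: its arcs form paths, one for each coordinate outside \<open>S\<close>, and the paths can
  be joined in any cyclic order. Since there are at least four paths, comparing the six cyclic orders of
  four segments shows that an equation valid on all these circuits has equal coefficients outside
  \<open>S\<close> (\<open>coeffs_equal_off_partial_tour\<close>). The sum of all coordinates is constant on circuits, so
  these coefficients may be taken to be 0, and the facet property becomes a statement on the tight
  assignments of \<open>S\<close> alone (\<open>facet_definingI\<close>): they must determine the equation up to a factor.
  Permuting the values on \<open>J\<close> shows that the coefficients on \<open>J\<close> agree
  (\<open>facet_defining_of_types\<close>). Three types of tight assignments, given by \<open>x\<^sub>m\<^sub>-\<^sub>1\<close>, \<open>x\<^sub>m\<close> and the set of
  values on \<open>J\<close>, then fix the ratio of the three remaining coefficients.

  The inequalities hold because the values on \<open>S\<close> are distinct positive integers subject to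
  \<open>x\<^sub>m\<^sub>-\<^sub>1 \<noteq> m-1\<close>, \<open>x\<^sub>m \<noteq> m\<close> and not \<open>x\<^sub>m\<^sub>-\<^sub>1 = m\<close>, \<open>x\<^sub>m = m-1\<close> simultaneously. With
  \<open>Q\<close> for the sum of the \<open>x\<^sub>j\<close> over \<open>j \<in> J\<close>, distinctness bounds \<open>Q\<close>, \<open>Q + x\<^sub>m\<^sub>-\<^sub>1\<close>, \<open>Q + x\<^sub>m\<close> and \<open>Q + x\<^sub>m\<^sub>-\<^sub>1 + x\<^sub>m\<close> from
  below by triangular numbers, and combining these bounds in each case left by the exclusions
  (\<open>tour_bounds\<close>) gives the right-hand sides.
\<close>

section \<open>Hamiltonian circuits from cyclic lists\<close>

definition tours :: "nat \<Rightarrow> (nat \<Rightarrow> nat) set" where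
  "tours n = {p. p permutes {1..n} \<and> cyclic_on p {1..n}}"

lemma map_cycle_of_list:
  assumes "distinct xs"
  shows "map (cycle_of_list xs) xs = rotate1 xs"
  using cyclic_rotation[OF assms, of 1] by simp

lemma cyclic_on_cycle_of_list:
  assumes "distinct xs" "xs \<noteq> []"
  shows "cyclic_on (cycle_of_list xs) (set xs)"
proof (rule cyclic_on_singleI)
  let ?c = "cycle_of_list xs"
  have pow: "(?c ^^ k) (hd xs) = hd (rotate k xs)" for k
    using cyclic_rotation[OF assms(1), of k] assms(2) by (metis hd_map)
  show "hd xs \<in> set xs" using assms by simp
  show "set xs = orbit ?c (hd xs)"
  proof (rule antisym)
    show "orbit ?c (hd xs) \<subseteq> set xs"
      using permutes_orbit_subset[OF cycle_permutes hd_in_set] assms by blast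
    show "set xs \<subseteq> orbit ?c (hd xs)"
    proof
      fix x assume "x \<in> set xs"
      then obtain k where k: "k < length xs" "x = xs ! k" by (metis in_set_conv_nth)
      then have "x = (?c ^^ k) (hd xs)" using pow[of k] by (simp add: hd_rotate_conv_nth assms)
      then show "x \<in> orbit ?c (hd xs)"
        by (auto simp: orbit_altdef_permutation[OF permutation_of_cycle])
    qed
  qed
qed

lemma cycle_of_list_in_tours:
  assumes "distinct xs" "set xs = {1..n}" "xs \<noteq> []"
  shows "cycle_of_list xs \<in> tours n"
  using assms cycle_permutes[of xs] cyclic_on_cycle_of_list[of xs] by (simp add: tours_def)

lemma cycle_of_list_consecutive:
  assumes "distinct (xs @ i # j # ys)"
  shows "cycle_of_list (xs @ i # j # ys) i = j"
proof -
  have "map (cycle_of_list (xs @ i # j # ys)) (xs @ i # j # ys) ! length xs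
      = rotate1 (xs @ i # j # ys) ! length xs"
    using map_cycle_of_list[OF assms] by simp
  then show ?thesis by (cases xs) (simp_all add: nth_append)
qed

text \<open>
  The value of a linear function at the circuit that runs through a list: each element is
  weighted by its successor, and the closing arc from the last element to the first is added
  separately. Cutting the circuit into segments then only costs the arcs at the cuts.
\<close>

fun path_weight :: "(nat \<Rightarrow> real) \<Rightarrow> nat list \<Rightarrow> real" where
  "path_weight a (x # y # zs) = a x * y + path_weight a (y # zs)"
| "path_weight a _ = 0"

lemma path_weight_append:
  assumes "xs \<noteq> []" "ys \<noteq> []"
  shows "path_weight a (xs @ ys) = path_weight a xs + a (last xs) * hd ys + path_weight a ys"
  using assms
proof (induction a xs rule: path_weight.induct)
  case (1 a x y zs) then show ?case by simp
next
  case ("2_2" a v) then show ?case by (cases ys) simp_all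
qed simp_all

lemma sum_cycle_of_list:
  fixes xs :: "nat list"
  assumes "distinct xs" "xs \<noteq> []"
  shows "(\<Sum>i\<in>set xs. a i * real (cycle_of_list xs i)) = path_weight a xs + a (last xs) * hd xs"
proof -
  have shifted: "(\<Sum>(i, j)\<leftarrow>zip zs (tl zs @ [z]). a i * real j)
      = path_weight a zs + a (last zs) * z" if "zs \<noteq> []" for zs z
    using that by (induction a zs rule: path_weight.induct) simp_all
  have "(\<Sum>i\<in>set xs. a i * real (cycle_of_list xs i)) = (\<Sum>i\<leftarrow>xs. a i * real (cycle_of_list xs i))"
    using assms(1) by (simp add: sum_list_distinct_conv_sum_set)
  also have "\<dots> = (\<Sum>(i, j)\<leftarrow>zip xs (map (cycle_of_list xs) xs). a i * real j)"
    by (simp add: zip_map2 zip_same_conv_map comp_def)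
  also have "\<dots> = path_weight a xs + a (last xs) * hd xs"
    using shifted[OF assms(2)] map_cycle_of_list[OF assms(1)] assms(2)
    by (simp add: rotate1_hd_tl)
  finally show ?thesis .
qed

section \<open>Completing an assignment of some coordinates to a circuit\<close>

text \<open>
  The rank function says that the arcs \<open>i \<mapsto> \<sigma> i\<close> close no cycle: a rank that drops along every arc
  can be written down at once for each assignment used below, whereas following the paths would
  need a case distinction on which of the values are themselves in \<open>S\<close>.
\<close>

definition partial_tour :: "nat \<Rightarrow> nat set \<Rightarrow> (nat \<Rightarrow> nat) \<Rightarrow> bool" where
  "partial_tour n S \<sigma> \<longleftrightarrow> S \<subseteq> {1..n} \<and> inj_on \<sigma> S \<and> \<sigma> ` S \<subseteq> {1..n} \<and>
     (\<exists>r :: nat \<Rightarrow> nat. \<forall>i\<in>S. r (\<sigma> i) < r i)"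

text \<open>
  The arcs of an acyclic partial injection on \<open>S\<close> form disjoint paths, one ending in each element
  \<open>u\<close> outside \<open>S\<close>; \<open>B u\<close> lists this path. Concatenating the paths in any order gives a circuit.
\<close>

definition path_cover :: "nat set \<Rightarrow> (nat \<Rightarrow> nat) \<Rightarrow> nat set \<Rightarrow> (nat \<Rightarrow> nat list) \<Rightarrow> bool" where
  "path_cover S \<sigma> U B \<longleftrightarrow>
     (\<forall>u\<in>U. B u \<noteq> [] \<and> last (B u) = u \<and> distinct (B u) \<and>
            successively (\<lambda>i j. i \<in> S \<and> j = \<sigma> i) (B u)) \<and>
     (\<forall>u\<in>U. \<forall>v\<in>U. u \<noteq> v \<longrightarrow> set (B u) \<inter> set (B v) = {}) \<and>
     (\<Union>u\<in>U. set (B u)) = U \<union> S"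

text \<open>
  Elements of \<open>S\<close> are added in the order of increasing rank. The new element \<open>s\<close> is then no
  value of \<open>\<sigma>\<close> on the old ones, and by injectivity \<open>\<sigma> s\<close> has no predecessor yet, so \<open>\<sigma> s\<close> is the first
  element of its path and \<open>s\<close> can be put in front of it.
\<close>

lemma path_cover_exists:
  fixes r :: "nat \<Rightarrow> nat"
  assumes "finite S" "S \<inter> U = {}" "inj_on \<sigma> S" "\<sigma> ` S \<subseteq> U \<union> S" "\<forall>i\<in>S. r (\<sigma> i) < r i"
  shows "\<exists>B. path_cover S \<sigma> U B"
  using assms
proof (induction rule: finite_ranking_induct[where f = r])
  case empty
  show ?case by (intro exI[of _ "\<lambda>u. [u]"]) (auto simp: path_cover_def)
next
  case (insert s S)
  show ?case
  proof (cases "s \<in> S")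
    case True
    then show ?thesis using insert by (simp add: insert_absorb)
  next
    case False
    have notin: "\<sigma> i \<noteq> s" if "i \<in> insert s S" for i
      using insert.hyps(2)[of i] insert.prems(4) that by fastforce
    have pre: "S \<inter> U = {}" "inj_on \<sigma> S" "\<sigma> ` S \<subseteq> U \<union> S" "\<forall>i\<in>S. r (\<sigma> i) < r i"
    proof -
      show "\<sigma> ` S \<subseteq> U \<union> S" using insert.prems(3) notin by fastforce
    qed (use insert.prems in \<open>auto simp: inj_on_def\<close>)
    obtain B where B: "path_cover S \<sigma> U B" using insert.IH[OF pre] by blast
    have B1: "B u \<noteq> [] \<and> last (B u) = u \<and> distinct (B u) \<and>
          successively (\<lambda>i j. i \<in> S \<and> j = \<sigma> i) (B u)" if "u \<in> U" for u
      using B that unfolding path_cover_def by blast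
    have B2: "set (B u) \<inter> set (B v) = {}" if "u \<in> U" "v \<in> U" "u \<noteq> v" for u v
      using B that unfolding path_cover_def by blast
    have B3: "(\<Union>u\<in>U. set (B u)) = U \<union> S"
      using B unfolding path_cover_def by blast
    have "\<sigma> s \<in> U \<union> S" using insert.prems(3) notin[of s] by auto
    then obtain u0 where u0: "u0 \<in> U" "\<sigma> s \<in> set (B u0)" using B3 by blast
    have hd: "hd (B u0) = \<sigma> s"
    proof -
      obtain us zs where split: "B u0 = us @ \<sigma> s # zs" using u0(2) by (meson split_list)
      have "us = []"
      proof (rule ccontr)
        assume "us \<noteq> []"
        then have "last us \<in> S" "\<sigma> s = \<sigma> (last us)"
          using B1[OF u0(1)] split by (auto simp: successively_append_iff)
        then show False using insert.prems(2) False by (auto simp: inj_on_def)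
      qed
      then show ?thesis using split by simp
    qed
    have s_new: "s \<notin> set (B u)" if "u \<in> U" for u
      using B3 that False insert.prems(1) by auto
    have step: "successively (\<lambda>i j. i \<in> insert s S \<and> j = \<sigma> i) (B u)" if "u \<in> U" for u
      using B1[OF that] by (auto intro: successively_mono)
    let ?B = "B(u0 := s # B u0)"
    have "path_cover (insert s S) \<sigma> U ?B"
      unfolding path_cover_def
    proof (intro conjI ballI impI)
      fix u assume u: "u \<in> U"
      show "?B u \<noteq> []" "last (?B u) = u" "distinct (?B u)"
        using B1[OF u] s_new[OF u] u by auto
      show "successively (\<lambda>i j. i \<in> insert s S \<and> j = \<sigma> i) (?B u)"
        using step[OF u] hd B1[OF u] by (auto simp: successively_Cons)
    next
      fix u v assume "u \<in> U" "v \<in> U" "u \<noteq> v"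
      then show "set (?B u) \<inter> set (?B v) = {}"
        using B2[of u v] s_new by auto
    next
      have "(\<Union>u\<in>U. set (?B u)) = insert s (\<Union>u\<in>U. set (B u))"
        using u0(1) by (auto split: if_splits)
      then show "(\<Union>u\<in>U. set (?B u)) = U \<union> insert s S" using B3 by auto
    qed
    then show ?thesis by blast
  qed
qed

lemma partial_tour_path_cover:
  assumes "partial_tour n S \<sigma>"
  obtains B where "path_cover S \<sigma> ({1..n} - S) B"
proof -
  obtain r where r: "\<forall>i\<in>S. r (\<sigma> i) < (r i :: nat)"
    using assms(1) by (auto simp: partial_tour_def)
  have "finite S" "S \<inter> ({1..n} - S) = {}" "inj_on \<sigma> S" "\<sigma> ` S \<subseteq> ({1..n} - S) \<union> S"
    using assms(1) by (auto simp: partial_tour_def intro: finite_subset)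
  from path_cover_exists[OF this r] show ?thesis using that by blast
qed

lemma path_cover_tour:
  assumes S: "S \<subseteq> {1..n}" and B: "path_cover S \<sigma> ({1..n} - S) B"
    and us: "distinct us" "set us = {1..n} - S" "us \<noteq> []"
  defines "xs \<equiv> concat (map B us)"
  shows "distinct xs" "set xs = {1..n}" "cycle_of_list xs \<in> tours n"
    "\<forall>i\<in>S. cycle_of_list xs i = \<sigma> i"
proof -
  define U where "U = {1..n} - S"
  have US: "U \<union> S = {1..n}" using S by (auto simp: U_def)
  have B1: "B u \<noteq> [] \<and> last (B u) = u \<and> distinct (B u) \<and>
        successively (\<lambda>i j. i \<in> S \<and> j = \<sigma> i) (B u)" if "u \<in> U" for u
    using B that unfolding path_cover_def U_def by blast
  have B2: "set (B u) \<inter> set (B v) = {}" if "u \<in> U" "v \<in> U" "u \<noteq> v" for u v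
    using B that unfolding path_cover_def U_def by blast
  have B3: "(\<Union>u\<in>U. set (B u)) = U \<union> S"
    using B unfolding path_cover_def U_def by blast
  have "distinct (concat (map B vs))" if "distinct vs" "set vs \<subseteq> U" for vs
    using that
  proof (induction vs)
    case (Cons v vs)
    have "set (B v) \<inter> set (B w) = {}" if "w \<in> set vs" for w
      using B2[of v w] Cons.prems that by auto
    then show ?case using Cons B1[of v] by auto
  qed simp
  then show dist: "distinct xs" using us unfolding xs_def U_def by blast
  show set: "set xs = {1..n}" using us B3 US by (auto simp: xs_def U_def)
  obtain u0 where "u0 \<in> set us" using us(3) by (cases us) auto
  then have "xs \<noteq> []" using B1[of u0] us(2) by (auto simp: xs_def U_def)
  then show "cycle_of_list xs \<in> tours n"
    using cycle_of_list_in_tours dist set by blast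
  show "\<forall>i\<in>S. cycle_of_list xs i = \<sigma> i"
  proof
    fix i assume i: "i \<in> S"
    then obtain u where u: "u \<in> U" "i \<in> set (B u)" using B3 by blast
    obtain ys zs where yz: "B u = ys @ i # zs" using u(2) by (meson split_list)
    have "i \<noteq> u" using i u(1) by (auto simp: U_def)
    then have "zs \<noteq> []" using B1[OF u(1)] yz by auto
    then obtain j ws where zs: "zs = j # ws" by (cases zs) auto
    have j: "j = \<sigma> i" using B1[OF u(1)] yz zs by (auto simp: successively_append_iff)
    have "u \<in> set us" using u(1) us(2) by (simp add: U_def)
    then obtain as bs where ab: "us = as @ u # bs" by (meson split_list)
    have eq: "xs = (concat (map B as) @ ys) @ i # \<sigma> i # (ws @ concat (map B bs))"
      using ab yz zs j by (simp add: xs_def)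
    show "cycle_of_list xs i = \<sigma> i"
      unfolding eq by (rule cycle_of_list_consecutive) (use dist eq in simp)
  qed
qed

lemma partial_tour_extends:
  assumes "partial_tour n S \<sigma>" "{1..n} - S \<noteq> {}"
  obtains p where "p \<in> tours n" "\<forall>i\<in>S. p i = \<sigma> i"
proof -
  obtain B where B: "path_cover S \<sigma> ({1..n} - S) B"
    using partial_tour_path_cover[OF assms(1)] .
  obtain us where us: "set us = {1..n} - S" "distinct us"
    using finite_distinct_list[of "{1..n} - S"] by auto
  have "us \<noteq> []" using us(1) assms(2) by auto
  moreover have "S \<subseteq> {1..n}" using assms(1) by (simp add: partial_tour_def)
  ultimately show ?thesis using path_cover_tour[OF _ B us(2,1)] that by blast
qed

text \<open>
  Four coordinates outside \<open>S\<close> cut a completion of \<open>\<sigma>\<close> into four segments, which can be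
  rearranged freely. With \<open>[A B C D]\<close> for the value at the cyclic arrangement of the segments
  \<open>A\<close>, \<open>B\<close>, \<open>C\<close>, \<open>D\<close>,
  \<open>[A B C D] + [A B D C] + [A C D B] - [A D C B] - [A D B C] - [A C B D]\<close> is
  \<open>2 (a\<^sub>A - a\<^sub>C) (h\<^sub>B - h\<^sub>D)\<close>, where \<open>a\<close> is the coefficient of the last and \<open>h\<close> the first element of a
  segment. If the six values agree, then \<open>a\<^sub>A = a\<^sub>C\<close>.
\<close>

lemma coeffs_equal_off_partial_tour:
  assumes pt: "partial_tour n S \<sigma>" and card: "card ({1..n} - S) \<ge> 4"
    and const: "\<And>p. p \<in> tours n \<Longrightarrow> (\<forall>i\<in>S. p i = \<sigma> i) \<Longrightarrow> (\<Sum>i=1..n. a i * real (p i)) = c"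
    and xz: "x \<in> {1..n} - S" "z \<in> {1..n} - S"
  shows "a x = a z"
proof (cases "x = z")
  case False
  define U where "U = {1..n} - S"
  have "card (U - {x, z}) \<ge> 2" "finite U"
    using card xz False by (auto simp: U_def card_Diff_subset)
  then obtain y w where yw: "y \<in> U - {x, z}" "w \<in> U - {x, z}" "y \<noteq> w"
    by (metis card_le_Suc0_iff_eq finite_Diff not_less_eq_eq numeral_2_eq_2)
  obtain vs where vs: "set vs = U - {x, y, z, w}" "distinct vs"
    using finite_distinct_list \<open>finite U\<close> by (metis finite_Diff)
  have S: "S \<subseteq> {1..n}" using pt by (simp add: partial_tour_def)
  obtain B where B: "path_cover S \<sigma> ({1..n} - S) B" using partial_tour_path_cover[OF pt] .
  have B1: "B u \<noteq> [] \<and> last (B u) = u" if "u \<in> U" for u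
    using B that unfolding path_cover_def U_def by blast
  \<comment> \<open>The fourth segment absorbs all the remaining paths.\<close>
  define D where "D = concat (map B vs) @ B w"
  have xyzw: "x \<in> U" "y \<in> U" "z \<in> U" "w \<in> U" using xz yw by (auto simp: U_def)
  note B1' = B1[OF xyzw(1)] B1[OF xyzw(2)] B1[OF xyzw(3)] B1[OF xyzw(4)]
  have D: "D \<noteq> []" "last D = w" using B1' by (auto simp: D_def)
  define ws where "ws = vs @ [w]"
  have ws: "distinct ws" "set ws = U - {x, y, z}"
    using vs yw xyzw unfolding ws_def by auto
  have order: "distinct ([i, j, k] @ ws)" "set ([i, j, k] @ ws) = {1..n} - S" "[i, j, k] @ ws \<noteq> []"
    if ijk: "distinct [i, j, k]" "{i, j, k} = {x, y, z}" for i j k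
  proof -
    have sijk: "set [i, j, k] = {x, y, z}" using ijk(2) by simp
    show "distinct ([i, j, k] @ ws)"
      unfolding distinct_append sijk ws(2) using ijk(1) ws(1) by blast
    show "set ([i, j, k] @ ws) = {1..n} - S"
      unfolding set_append sijk ws(2) using xyzw unfolding U_def by blast
  qed simp
  have conc: "concat (map B ([i, j, k] @ ws)) = B i @ B j @ B k @ D" for i j k
    by (simp add: D_def ws_def)
  let ?P = "path_weight a"
  have six: "?P (B i) + a i * hd (B j) + (?P (B j) + a j * hd (B k) + (?P (B k) + a k * hd D + ?P D))
      + a w * hd (B i) = c" if ijk: "distinct [i, j, k]" "{i, j, k} = {x, y, z}" for i j k
  proof -
    let ?xs = "B i @ B j @ B k @ D"
    have "{i, j, k} \<subseteq> U" unfolding ijk(2) using xyzw by blast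
    then have U: "i \<in> U" "j \<in> U" "k \<in> U" by blast+
    note B1'' = B1[OF U(1)] B1[OF U(2)] B1[OF U(3)]
    note tour = path_cover_tour[OF S B order[OF ijk], unfolded conc]
    have ne: "?xs \<noteq> []" using D(1) by simp
    have "c = (\<Sum>i\<in>set ?xs. a i * real (cycle_of_list ?xs i))"
      using const[OF tour(3,4)] unfolding tour(2) by simp
    also have "\<dots> = ?P ?xs + a (last ?xs) * hd ?xs"
      by (rule sum_cycle_of_list[OF tour(1) ne])
    finally show ?thesis using D B1'' by (simp add: path_weight_append)
  qed
  have d: "x \<noteq> y" "y \<noteq> z" "x \<noteq> z" using False yw by auto
  have hds: "hd (B y) \<noteq> hd D"
  proof -
    have "distinct [x, y, z]" using d by simp
    then have "distinct (B x @ B y @ B z @ D)"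
      using path_cover_tour(1)[OF S B order] unfolding conc by blast
    then have "set (B y) \<inter> set D = {}" by auto
    then show ?thesis using B1'[THEN conjunct1] D(1) by (metis disjoint_iff hd_in_set)
  qed
  have e: "distinct [x, y, z]" "{x, y, z} = {x, y, z}" "distinct [x, z, y]" "{x, z, y} = {x, y, z}"
    "distinct [y, x, z]" "{y, x, z} = {x, y, z}" "distinct [y, z, x]" "{y, z, x} = {x, y, z}"
    "distinct [z, x, y]" "{z, x, y} = {x, y, z}" "distinct [z, y, x]" "{z, y, x} = {x, y, z}"
    using d by auto
  have "a x * hd (B y) - a x * hd D - a z * hd (B y) + a z * hd D = 0"
    using six[OF e(1,2)] six[OF e(3,4)] six[OF e(5,6)] six[OF e(7,8)] six[OF e(9,10)] six[OF e(11,12)]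
    by linarith
  then have "(a x - a z) * (real (hd (B y)) - real (hd D)) = 0"
    by (simp add: algebra_simps)
  then show ?thesis using hds by simp
qed simp

section \<open>A criterion for facets\<close>

text \<open>
  If every linear equation valid on the tight points is, on \<open>K\<close>, a multiple of \<open>f x = b\<close>, then the
  tight points together with a single slack point \<open>q\<close> already span the affine hull of \<open>K\<close>: an
  equation valid on all of these holds at \<open>q\<close>, so the multiple is zero. Hence the face has
  codimension one, whatever the dimension of the polytope is.
\<close>

lemma facet_defining_convex_hullI:
  fixes K :: "'a::euclidean_space set"
  assumes lin: "linear f" and valid: "\<And>x. x \<in> K \<Longrightarrow> b \<le> f x"
    and tight: "t \<in> K" "f t = b" and slack: "q \<in> K" "f q \<noteq> b"
    and unique: "\<And>a c. (\<And>x. x \<in> K \<Longrightarrow> f x = b \<Longrightarrow> a \<bullet> x = c) \<Longrightarrow>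
                   \<exists>l. \<forall>x\<in>K. a \<bullet> x - c = l * (f x - b)"
  shows "facet_defining (convex hull K) f b"
proof -
  define w where "w = adjoint f 1"
  have f: "f x = w \<bullet> x" for x
    using adjoint_works[OF lin, of x 1] by (simp add: w_def inner_commute)
  define P where "P = convex hull K"
  define F where "F = P \<inter> {x. w \<bullet> x = b}"
  have hull: "g \<bullet> x = c" if "\<And>x. x \<in> K \<Longrightarrow> g \<bullet> x = c" "x \<in> P" for g c x
    using hull_minimal[of K "{x. g \<bullet> x = c}" convex] that
    by (auto simp: P_def convex_hyperplane)
  have KP: "K \<subseteq> P" unfolding P_def by (rule hull_subset)
  have valid_P: "b \<le> w \<bullet> x" if "x \<in> P" for x
    using hull_minimal[of K "{x. b \<le> w \<bullet> x}" convex] valid that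
    by (auto simp: P_def f convex_halfspace_ge)
  have face: "F face_of P"
    unfolding F_def by (rule face_of_Int_supporting_hyperplane_ge) (auto simp: P_def valid_P[unfolded P_def])
  have ne: "t \<in> F" using tight KP by (auto simp: F_def f)
  have qP: "q \<in> P" using slack KP by auto
  have F_hull: "affine hull F \<subseteq> {x. w \<bullet> x = b}"
    by (rule hull_minimal) (auto simp: F_def affine_hyperplane)
  then have q_notin: "q \<notin> affine hull F" using slack by (auto simp: f)
  have sub: "P \<subseteq> affine hull (insert q F)"
  proof -
    obtain \<F> where \<F>: "affine hull (insert q F) = \<Inter>\<F>"
      "\<And>h. h \<in> \<F> \<Longrightarrow> \<exists>g c. g \<noteq> 0 \<and> h = {x. g \<bullet> x = c}"
      by (rule affine_hull_finite_intersection_hyperplanes[of "insert q F"]) blast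
    have "P \<subseteq> h" if h: "h \<in> \<F>" for h
    proof -
      obtain g c where gc: "h = {x. g \<bullet> x = c}" using \<F>(2)[OF h] by blast
      have on: "g \<bullet> x = c" if "x \<in> insert q F" for x
        using hull_inc[of x "insert q F" affine] that \<F>(1) h gc by blast
      have "g \<bullet> x = c" if "x \<in> K" "f x = b" for x
        using on[of x] that KP by (auto simp: F_def f)
      then obtain l where l: "\<And>x. x \<in> K \<Longrightarrow> g \<bullet> x - c = l * (f x - b)"
        using unique[of g c] by blast
      have "l = 0" using l[OF slack(1)] on[of q] slack(2) by simp
      then have "g \<bullet> x = c" if "x \<in> K" for x using l[OF that] by simp
      then show ?thesis using hull[of g c] gc by blast
    qed
    then show ?thesis using \<F>(1) by blast
  qed
  have "affine hull (insert q F) = affine hull P"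
  proof (rule antisym)
    have "insert q F \<subseteq> P" using qP by (auto simp: F_def)
    then show "affine hull (insert q F) \<subseteq> affine hull P" by (rule hull_mono)
    show "affine hull P \<subseteq> affine hull (insert q F)"
      using sub by (rule hull_minimal) (rule affine_affine_hull)
  qed
  then have "aff_dim P = aff_dim (insert q F)" by (metis aff_dim_affine_hull)
  then have "aff_dim F = aff_dim P - 1" using q_notin by (simp add: aff_dim_insert)
  then have "F facet_of P" using face ne by (auto simp: facet_of_def)
  moreover have "{x \<in> convex hull K. f x = b} = F" by (auto simp: F_def P_def f)
  ultimately show ?thesis
    using lin valid_P by (simp add: facet_defining_def P_def f)
qed

lemma sum_tour:
  assumes "p \<in> tours n"
  shows "(\<Sum>i=1..n. real (p i)) = (\<Sum>i=1..n. real i)"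
  using assms sum.permute[of p "{1..n}" real] by (simp add: tours_def comp_def)

lemma circuits_eq:
  fixes e :: "nat \<Rightarrow> 'n::finite"
  assumes "n = CARD('n)"
  shows "circuits e = {x. \<exists>p\<in>tours n. \<forall>i\<in>{1..n}. x $ e i = real (p i)}"
  using assms unfolding circuits_def tours_def by auto

text \<open>
  For an inequality in the coordinates in \<open>S\<close> it is enough to look at assignments of these
  coordinates. An equation valid on the tight circuits has the same coefficient \<open>\<mu>\<close> at all coordinates
  outside \<open>S\<close>; subtracting \<open>\<mu>\<close> times the constant sum of all coordinates leaves an equation
  supported on \<open>S\<close>, which \<open>span\<close> identifies as a multiple of the inequality.
\<close>

lemma facet_definingI:
  fixes e :: "nat \<Rightarrow> 'n::finite" and w :: "nat \<Rightarrow> real"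
  assumes n: "n = CARD('n)" and e: "bij_betw e {1..n} UNIV"
    and S: "S \<subseteq> {1..n}" "card S + 4 \<le> n" "s \<in> S" "w s \<noteq> 0"
    and valid: "\<And>p. p \<in> tours n \<Longrightarrow> b \<le> (\<Sum>i\<in>S. w i * p i)"
    and tight: "\<And>\<sigma>. \<sigma> \<in> T \<Longrightarrow> partial_tour n S \<sigma> \<and> (\<Sum>i\<in>S. w i * \<sigma> i) = b" "T \<noteq> {}"
    and span: "\<And>a c. (\<And>\<sigma>. \<sigma> \<in> T \<Longrightarrow> (\<Sum>i\<in>S. a i * real (\<sigma> i)) = c) \<Longrightarrow> \<exists>l. \<forall>i\<in>S. a i = l * w i"
  shows "facet_defining (circuit_polytope e) (\<lambda>x. \<Sum>i\<in>S. w i * x $ e i) b"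
proof -
  define U where "U = {1..n} - S"
  have fin: "finite S" using S(1) finite_subset by blast
  have cardU: "card U \<ge> 4" using S(1,2) fin by (simp add: U_def card_Diff_subset)
  then obtain u where u: "u \<in> U" by fastforce
  then have ne: "{1..n} - S \<noteq> {}" by (auto simp: U_def)
  have split: "(\<Sum>i=1..n. g i) = (\<Sum>i\<in>S. g i) + (\<Sum>i\<in>U. g i)" for g :: "nat \<Rightarrow> real"
    using sum.subset_diff[OF S(1), of g] by (simp add: U_def)
  have ext: "(\<Sum>i=1..n. (if i \<in> S then w i else 0) * g i) = (\<Sum>i\<in>S. w i * g i)" for g :: "nat \<Rightarrow> real"
    unfolding split by (simp add: U_def)
  define point where "point p = (\<chi> k. real (p (inv_into {1..n} e k)))" for p :: "nat \<Rightarrow> nat"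
  have point: "point p $ e i = real (p i)" if "i \<in> {1..n}" for p i
    using e that by (simp add: point_def bij_betw_inv_into_left)
  have circ: "circuits e = {x. \<exists>p\<in>tours n. \<forall>i\<in>{1..n}. x $ e i = real (p i)}"
    by (rule circuits_eq[OF n])
  have point_circ: "point p \<in> circuits e" if "p \<in> tours n" for p
    using that point by (auto simp: circ)
  have f_point: "(\<Sum>i\<in>S. w i * point p $ e i) = (\<Sum>i\<in>S. w i * real (p i))" for p
    using S(1) point by (intro sum.cong) auto
  have inner: "a \<bullet> point p = (\<Sum>i=1..n. a $ e i * real (p i))" for a p
  proof -
    have "a \<bullet> point p = (\<Sum>k\<in>UNIV. a $ k * point p $ k)" by (simp add: inner_vec_def)
    also have "\<dots> = (\<Sum>i=1..n. a $ e i * point p $ e i)"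
      using sum.reindex_bij_betw[OF e, of "\<lambda>k. a $ k * point p $ k"] by simp
    finally show ?thesis using point by simp
  qed
  have circ_point: "\<exists>p\<in>tours n. x = point p" if "x \<in> circuits e" for x
  proof -
    from that obtain p where p: "p \<in> tours n" "\<forall>i\<in>{1..n}. x $ e i = real (p i)"
      unfolding circ by blast
    have "x $ k = point p $ k" for k
    proof -
      obtain i where "i \<in> {1..n}" "k = e i" using e by (metis UNIV_I bij_betw_imp_surj_on imageE)
      then show ?thesis using p(2) point by simp
    qed
    then show ?thesis using p(1) by (auto simp: vec_eq_iff)
  qed
  obtain \<sigma>0 where \<sigma>0: "\<sigma>0 \<in> T" using tight(2) by blast
  have extend: "\<exists>p\<in>tours n. \<forall>i\<in>S. p i = \<sigma> i" if "\<sigma> \<in> T" for \<sigma>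
    using partial_tour_extends[of n S \<sigma>] tight(1)[OF that] ne by blast
  have ext_tight: "(\<Sum>i\<in>S. w i * real (p i)) = b" if "\<sigma> \<in> T" "\<forall>i\<in>S. p i = \<sigma> i" for p \<sigma>
  proof -
    have "(\<Sum>i\<in>S. w i * real (p i)) = (\<Sum>i\<in>S. w i * real (\<sigma> i))"
      using that(2) by (intro sum.cong) auto
    then show ?thesis using tight(1)[OF that(1)] by simp
  qed
  obtain p0 where p0: "p0 \<in> tours n" "\<forall>i\<in>S. p0 i = \<sigma>0 i" using extend[OF \<sigma>0] by blast
  \<comment> \<open>The inequality is not an equation: with no value
      prescribed, \<open>coeffs_equal_off_partial_tour\<close> would make all its coefficients equal, but \<open>u\<close> has coefficient 0 and \<open>s\<close> has not.\<close>
  have "\<exists>q\<in>tours n. (\<Sum>i\<in>S. w i * real (q i)) \<noteq> b"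
  proof (rule ccontr)
    assume none: "\<not> ?thesis"
    have "(if s \<in> S then w s else 0) = (if u \<in> S then w u else 0)"
    proof (rule coeffs_equal_off_partial_tour[where S = "{}" and \<sigma> = id and n = n and c = b])
      show "partial_tour n {} id" by (simp add: partial_tour_def)
      show "4 \<le> card ({1..n} - {})" using S(2) by simp
      show "(\<Sum>i=1..n. (if i \<in> S then w i else 0) * real (p i)) = b" if "p \<in> tours n" for p
        unfolding ext using none that by blast
      show "s \<in> {1..n} - {}" "u \<in> {1..n} - {}" using S(1,3) u by (auto simp: U_def)
    qed
    then show False using S(3,4) u by (simp add: U_def)
  qed
  then obtain q where q: "q \<in> tours n" "(\<Sum>i\<in>S. w i * real (q i)) \<noteq> b" by blast
  show ?thesis unfolding circuit_polytope_def
  proof (rule facet_defining_convex_hullI)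
    show "linear (\<lambda>x::real^'n. \<Sum>i\<in>S. w i * x $ e i)"
      by (intro linear_compose_sum ballI linearI) (simp_all add: algebra_simps)
    show "b \<le> (\<Sum>i\<in>S. w i * x $ e i)" if x: "x \<in> circuits e" for x
      using circ_point[OF x] valid f_point by auto
    show "point p0 \<in> circuits e" "point q \<in> circuits e" using p0 q point_circ by auto
    show "(\<Sum>i\<in>S. w i * point p0 $ e i) = b" using f_point ext_tight[OF \<sigma>0] p0 by simp
    show "(\<Sum>i\<in>S. w i * point q $ e i) \<noteq> b" using f_point q by simp
    fix a :: "real^'n" and c
    assume on_tight: "\<And>x. x \<in> circuits e \<Longrightarrow> (\<Sum>i\<in>S. w i * x $ e i) = b \<Longrightarrow> a \<bullet> x = c"
    have eq: "(\<Sum>i=1..n. a $ e i * real (p i)) = c"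
      if "p \<in> tours n" "\<sigma> \<in> T" "\<forall>i\<in>S. p i = \<sigma> i" for p \<sigma>
      using on_tight[OF point_circ[OF that(1)]] f_point ext_tight[OF that(2,3)] inner by simp
    define mu where "mu = a $ e u"
    have mu: "a $ e i = mu" if "i \<in> U" for i
      unfolding mu_def
      by (rule coeffs_equal_off_partial_tour[where S = S and \<sigma> = \<sigma>0 and n = n and c = c])
        (use tight(1)[OF \<sigma>0] cardU eq[OF _ \<sigma>0] that u in \<open>auto simp: U_def\<close>)
    define N where "N = (\<Sum>i=1..n. real i)"
    have shift: "(\<Sum>i=1..n. a $ e i * real (p i)) = (\<Sum>i\<in>S. (a $ e i - mu) * real (p i)) + mu * N"
      if "p \<in> tours n" for p
    proof -
      have "(\<Sum>i=1..n. (a $ e i - mu) * real (p i)) = (\<Sum>i\<in>S. (a $ e i - mu) * real (p i))"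
        unfolding split using mu by simp
      moreover have "(\<Sum>i=1..n. (a $ e i - mu) * real (p i))
          = (\<Sum>i=1..n. a $ e i * real (p i)) - mu * (\<Sum>i=1..n. real (p i))"
        by (simp add: left_diff_distrib sum_subtractf sum_distrib_left)
      ultimately show ?thesis unfolding N_def sum_tour[OF that] by linarith
    qed
    have "(\<Sum>i\<in>S. (a $ e i - mu) * real (\<sigma> i)) = c - mu * N" if \<sigma>: "\<sigma> \<in> T" for \<sigma>
    proof -
      obtain p where p: "p \<in> tours n" "\<forall>i\<in>S. p i = \<sigma> i" using extend[OF \<sigma>] by blast
      have "(\<Sum>i\<in>S. (a $ e i - mu) * real (\<sigma> i)) = (\<Sum>i\<in>S. (a $ e i - mu) * real (p i))"
        using p(2) by (intro sum.cong) auto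
      then show ?thesis using shift[OF p(1)] eq[OF p(1) \<sigma> p(2)] by simp
    qed
    from span[OF this] obtain l where l: "\<forall>i\<in>S. a $ e i - mu = l * w i" by blast
    have inner_l: "a \<bullet> point p = l * (\<Sum>i\<in>S. w i * real (p i)) + mu * N" if "p \<in> tours n" for p
      unfolding inner shift[OF that] using l by (simp add: sum_distrib_left mult.assoc)
    have "c = l * b + mu * N"
      using inner_l[OF p0(1)] inner eq[OF p0(1) \<sigma>0 p0(2)] ext_tight[OF \<sigma>0 p0(2)] by simp
    then have "\<forall>x\<in>circuits e. a \<bullet> x - c = l * ((\<Sum>i\<in>S. w i * x $ e i) - b)"
      using circ_point inner_l f_point by (fastforce simp: algebra_simps)
    then show "\<exists>l. \<forall>x\<in>circuits e. a \<bullet> x - c = l * ((\<Sum>i\<in>S. w i * x $ e i) - b)" by blast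
  qed
qed

section \<open>Lower bounds for sums of coordinates of a circuit\<close>

lemma tours_values:
  assumes "p \<in> tours n" "i \<in> {1..n}"
  shows "p i \<in> {1..n}"
  using assms permutes_in_image[of p "{1..n}" i] by (simp add: tours_def)

lemma tours_no_short_cycle:
  assumes p: "p \<in> tours n" and A: "A \<subseteq> {1..n}" "A \<noteq> {}" "card A < n"
  shows "\<not> p ` A \<subseteq> A"
proof
  assume closed: "p ` A \<subseteq> A"
  obtain i where i: "i \<in> A" using A(2) by blast
  have "j \<in> A" if "j \<in> orbit p i" for j
    using that by induction (use i closed in auto)
  moreover have "orbit p i = {1..n}"
    using p i A(1) by (auto simp: tours_def cyclic_on_alldef)
  ultimately have "{1..n} \<subseteq> A" by blast
  then have "n \<le> card A" using card_mono[of A "{1..n}"] A(1) finite_subset[of A] by auto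
  then show False using A(3) by simp
qed

lemma sum_ge_triangular:
  fixes A :: "nat set"
  assumes "finite A" "0 \<notin> A"
  shows "\<Sum>{1..card A} \<le> \<Sum>A"
  using assms
proof (induction "card A" arbitrary: A)
  case (Suc c)
  then have ne: "A \<noteq> {}" by auto
  have "A \<subseteq> {1..Max A}" using Suc.prems by (auto simp: Suc_le_eq intro!: gr0I)
  then have "card A \<le> Max A" using card_mono[of "{1..Max A}" A] by simp
  moreover have "\<Sum>{1..c} \<le> \<Sum>(A - {Max A})"
  proof -
    have c: "c = card (A - {Max A})" using Suc.hyps(2) Suc.prems ne by simp
    show ?thesis using Suc.hyps(1)[OF c] Suc.prems c by simp
  qed
  moreover have "\<Sum>A = Max A + \<Sum>(A - {Max A})"
    using sum.remove[of A "Max A" "\<lambda>x. x"] Suc.prems ne by simp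
  ultimately show ?case unfolding Suc.hyps(2)[symmetric] by simp
qed simp

lemma tours_sum_ge:
  assumes p: "p \<in> tours n" and A: "A \<subseteq> {1..n}"
  shows "\<Sum>{1..card A} \<le> (\<Sum>i\<in>A. p i)"
proof -
  have inj: "inj_on p A"
    using p permutes_inj_on by (auto simp: tours_def)
  have "0 \<notin> p ` A" using tours_values[OF p] A by fastforce
  then have "\<Sum>{1..card (p ` A)} \<le> \<Sum>(p ` A)"
    using sum_ge_triangular[of "p ` A"] A finite_subset[OF A] by simp
  then show ?thesis using inj by (simp add: card_image sum.reindex)
qed

section \<open>Inequalities with one common coefficient on a set of coordinates\<close>

text \<open>
  A type \<open>(x, y, V)\<close> prescribes the values at \<open>s\<close> and \<open>t\<close> and only the set \<open>V\<close> of values on \<open>J\<close>. The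
  rank bounds every value in \<open>V\<close> against every element of \<open>J\<close>, so that each bijection from \<open>J\<close> to \<open>V\<close>
  gives an assignment without cycles.
\<close>

definition admissible_type ::
  "nat \<Rightarrow> nat \<Rightarrow> nat \<Rightarrow> nat set \<Rightarrow> nat \<times> nat \<times> nat set \<Rightarrow> bool" where
  "admissible_type n s t J = (\<lambda>(x, y, V).
     x \<noteq> y \<and> x \<notin> V \<and> y \<notin> V \<and> finite V \<and> card V = card J \<and> insert x (insert y V) \<subseteq> {1..n} \<and>
     (\<exists>r :: nat \<Rightarrow> nat. r x < r s \<and> r y < r t \<and> (\<forall>j\<in>J. \<forall>v\<in>V. r v < r j)))"

lemma partial_tour_of_type:
  assumes type: "admissible_type n s t J (x, y, V)"
    and st: "insert s (insert t J) \<subseteq> {1..n}" "s \<noteq> t" "s \<notin> J" "t \<notin> J"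
    and \<sigma>: "\<sigma> s = x" "\<sigma> t = y" "bij_betw \<sigma> J V"
  shows "partial_tour n (insert s (insert t J)) \<sigma>"
proof -
  have xyV: "x \<noteq> y" "x \<notin> V" "y \<notin> V" "insert x (insert y V) \<subseteq> {1..n}"
    using type unfolding admissible_type_def by simp_all
  have "\<exists>r :: nat \<Rightarrow> nat. r x < r s \<and> r y < r t \<and> (\<forall>j\<in>J. \<forall>v\<in>V. r v < r j)"
    using type unfolding admissible_type_def by simp
  then obtain r :: "nat \<Rightarrow> nat"
    where r: "r x < r s" "r y < r t" "\<forall>j\<in>J. \<forall>v\<in>V. r v < r j" by blast
  have img: "\<sigma> ` J = V" and inj: "inj_on \<sigma> J" using \<sigma>(3) by (auto simp: bij_betw_def)
  have "r (\<sigma> i) < r i" if "i \<in> insert s (insert t J)" for i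
    using that
  proof (elim insertE)
    assume "i \<in> J"
    then have "\<sigma> i \<in> V" using img by blast
    then show ?thesis using r(3) \<open>i \<in> J\<close> by blast
  qed (use r \<sigma> in simp_all)
  moreover have "inj_on \<sigma> (insert s (insert t J))"
    unfolding inj_on_insert using inj \<sigma>(1,2) img xyV(1-3) by auto
  moreover have "\<sigma> ` insert s (insert t J) \<subseteq> {1..n}"
    using xyV(4) \<sigma>(1,2) img by simp
  ultimately show ?thesis using st(1) unfolding partial_tour_def by blast
qed

text \<open>
  Swapping two values on \<open>J\<close> keeps the type, hence tightness, so an equation valid on the tight
  circuits has a single coefficient \<open>\<gamma>\<close> on \<open>J\<close>. What remains is a linear system for the three
  coefficients, with one equation for each type.
\<close>

lemma facet_defining_of_types:
  fixes e :: "nat \<Rightarrow> 'n::finite" and k1 k2 k3 b :: nat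
  assumes n: "n = CARD('n)" and e: "bij_betw e {1..n} UNIV"
    and st: "insert s (insert t J) \<subseteq> {1..n}" "s \<noteq> t" "s \<notin> J" "t \<notin> J"
    and J: "J \<noteq> {}" "card J + 6 \<le> n" and k3: "k3 > 0"
    and valid: "\<And>p. p \<in> tours n \<Longrightarrow> b \<le> k1 * p s + k2 * p t + k3 * (\<Sum>j\<in>J. p j)"
    and types: "\<And>x y V. (x, y, V) \<in> T \<Longrightarrow>
        admissible_type n s t J (x, y, V) \<and> k1 * x + k2 * y + k3 * \<Sum>V = b" "T \<noteq> {}"
    and span: "\<And>(\<alpha>::real) (\<beta>::real) (\<gamma>::real) (c::real).
        (\<And>x y V. (x, y, V) \<in> T \<Longrightarrow> \<alpha> * real x + \<beta> * real y + \<gamma> * real (\<Sum>V) = c) \<Longrightarrow>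
        \<exists>l. \<alpha> = l * real k1 \<and> \<beta> = l * real k2 \<and> \<gamma> = l * real k3"
  shows "facet_defining (circuit_polytope e)
           (\<lambda>x. k1 * x $ e s + k2 * x $ e t + k3 * (\<Sum>j\<in>J. x $ e j)) b"
proof -
  define S where "S = insert s (insert t J)"
  define w where "w i = real (if i = s then k1 else if i = t then k2 else k3)" for i
  define A where "A = {\<sigma>. \<exists>x y V. (x, y, V) \<in> T \<and> \<sigma> s = x \<and> \<sigma> t = y \<and> bij_betw \<sigma> J V}"
  have finJ: "finite J" using st(1) finite_subset[of J "{1..n}"] by auto
  have sumS: "(\<Sum>i\<in>S. g i) = g s + (g t + (\<Sum>j\<in>J. g j))" for g :: "nat \<Rightarrow> real"
    using finJ st by (simp add: S_def)
  have wJ: "w j = k3" if "j \<in> J" for j using that st by (auto simp: w_def)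
  have sumw: "(\<Sum>i\<in>S. w i * g i) = k1 * g s + k2 * g t + k3 * (\<Sum>j\<in>J. g j)" for g :: "nat \<Rightarrow> real"
    unfolding sumS using wJ st(2) by (simp add: w_def sum_distrib_left)
  have type_bij: "\<exists>\<sigma>\<in>A. \<sigma> s = x \<and> \<sigma> t = y \<and> bij_betw \<sigma> J V" if xyV: "(x, y, V) \<in> T" for x y V
  proof -
    have "finite V" "card J = card V" using types(1)[OF xyV] by (auto simp: admissible_type_def)
    then obtain h where h: "bij_betw h J V" using finJ finite_same_card_bij by blast
    let ?\<sigma> = "h(s := x, t := y)"
    have "bij_betw ?\<sigma> J V \<longleftrightarrow> bij_betw h J V"
      using st by (intro bij_betw_cong) auto
    then have "bij_betw ?\<sigma> J V" using h by simp
    then show ?thesis using xyV st(2) unfolding A_def by (intro bexI[of _ ?\<sigma>]) auto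
  qed
  have sum_bij: "(\<Sum>j\<in>J. real (\<sigma> j)) = real (\<Sum>V)" if "bij_betw \<sigma> J V" for \<sigma> V
    using sum.reindex_bij_betw[OF that, of real] by simp
  obtain j where j: "j \<in> J" using J(1) by blast
  have "facet_defining (circuit_polytope e) (\<lambda>x. \<Sum>i\<in>S. w i * x $ e i) (real b)"
  proof (rule facet_definingI[OF n e])
    show "S \<subseteq> {1..n}" using st(1) by (simp add: S_def)
    show "card S + 4 \<le> n" using st finJ J(2) by (simp add: S_def)
    show "j \<in> S" "w j \<noteq> 0" using j wJ k3 by (auto simp: S_def)
    show "real b \<le> (\<Sum>i\<in>S. w i * real (p i))" if "p \<in> tours n" for p
    proof -
      have "real b \<le> real (k1 * p s + k2 * p t + k3 * (\<Sum>j\<in>J. p j))"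
        using valid[OF that] by (rule of_nat_mono)
      then show ?thesis unfolding sumw by simp
    qed
    show "A \<noteq> {}"
    proof -
      obtain x y V where "(x, y, V) \<in> T" using types(2) by auto
      then show ?thesis using type_bij by blast
    qed
    show "partial_tour n S \<sigma> \<and> (\<Sum>i\<in>S. w i * real (\<sigma> i)) = real b" if "\<sigma> \<in> A" for \<sigma>
    proof -
      from that obtain x y V where \<sigma>: "(x, y, V) \<in> T" "\<sigma> s = x" "\<sigma> t = y" "bij_betw \<sigma> J V"
        unfolding A_def by blast
      have "(\<Sum>i\<in>S. w i * real (\<sigma> i)) = real (k1 * x + k2 * y + k3 * \<Sum>V)"
        unfolding sumw sum_bij[OF \<sigma>(4)] \<sigma>(2,3) by simp
      moreover have "partial_tour n S \<sigma>"
        using partial_tour_of_type[OF _ st \<sigma>(2-4)] types(1)[OF \<sigma>(1)] by (simp add: S_def)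
      ultimately show ?thesis using types(1)[OF \<sigma>(1)] by simp
    qed
    fix a :: "nat \<Rightarrow> real" and c
    assume on: "\<And>\<sigma>. \<sigma> \<in> A \<Longrightarrow> (\<Sum>i\<in>S. a i * real (\<sigma> i)) = c"
    have const: "a i = a j" if ij: "i \<in> J" for i
    proof (cases "i = j")
      case False
      obtain x y V where xyV: "(x, y, V) \<in> T" using types(2) by auto
      obtain \<sigma> where \<sigma>: "\<sigma> \<in> A" "\<sigma> s = x" "\<sigma> t = y" "bij_betw \<sigma> J V"
        using type_bij[OF xyV] by blast
      let ?\<tau> = "\<sigma> \<circ> Transposition.transpose i j"
      have "bij_betw (Transposition.transpose i j) J J"
        by (rule permutes_imp_bij[OF permutes_swap_id[OF ij j]])
      then have "bij_betw ?\<tau> J V" by (rule bij_betw_trans[OF _ \<sigma>(4)])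
      moreover have vals: "?\<tau> s = x" "?\<tau> t = y"
        using ij j st \<sigma>(2,3) by (auto simp: Transposition.transpose_def)
      ultimately have "?\<tau> \<in> A" using xyV unfolding A_def by blast
      then have "(\<Sum>l\<in>J. a l * real (?\<tau> l)) = (\<Sum>l\<in>J. a l * real (\<sigma> l))"
        using on[of ?\<tau>] on[OF \<sigma>(1)] unfolding sumS vals \<sigma>(2,3) by linarith
      moreover have "(\<Sum>l\<in>J. g l) = g i + (g j + (\<Sum>l\<in>J - {i} - {j}. g l))" for g :: "nat \<Rightarrow> real"
        using finJ ij j False by (simp add: sum.remove[of J i] sum.remove[of "J - {i}" j])
      moreover have "(\<Sum>l\<in>J - {i} - {j}. a l * real (?\<tau> l)) = (\<Sum>l\<in>J - {i} - {j}. a l * real (\<sigma> l))"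
        by (intro sum.cong) (auto simp: Transposition.transpose_def)
      ultimately have "a i * real (\<sigma> j) + a j * real (\<sigma> i) = a i * real (\<sigma> i) + a j * real (\<sigma> j)"
        by simp
      then have "(a i - a j) * (real (\<sigma> i) - real (\<sigma> j)) = 0" by (simp add: algebra_simps)
      moreover have "\<sigma> i \<noteq> \<sigma> j"
        using \<sigma>(4) ij j False by (auto simp: bij_betw_def inj_on_def)
      ultimately show ?thesis by simp
    qed simp
    have "a s * real x + a t * real y + a j * real (\<Sum>V) = c" if xyV: "(x, y, V) \<in> T" for x y V
    proof -
      obtain \<sigma> where \<sigma>: "\<sigma> \<in> A" "\<sigma> s = x" "\<sigma> t = y" "bij_betw \<sigma> J V"
        using type_bij[OF xyV] by blast
      have "(\<Sum>l\<in>J. a l * real (\<sigma> l)) = a j * (\<Sum>l\<in>J. real (\<sigma> l))"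
        unfolding sum_distrib_left using const by (intro sum.cong) auto
      then show ?thesis using on[OF \<sigma>(1)] unfolding sumS sum_bij[OF \<sigma>(4)] \<sigma>(2,3) by simp
    qed
    from span[OF this] obtain l where l: "a s = l * real k1" "a t = l * real k2" "a j = l * real k3" by blast
    have "a i = l * w i" if "i \<in> S" for i
    proof (cases "i \<in> J")
      case True
      then show ?thesis using const wJ l by simp
    next
      case False
      then show ?thesis using that l st(2) by (auto simp: S_def w_def)
    qed
    then show "\<exists>l. \<forall>i\<in>S. a i = l * w i" by blast
  qed
  then show ?thesis unfolding sumw .
qed

section \<open>The five inequalities\<close>

text \<open>
  From here on \<open>m = k + 3\<close>, so the two special coordinates are \<open>k + 2\<close> and \<open>k + 3\<close>. Elements up to
  \<open>k + 1\<close> start no arc and get rank 0. The ranks \<open>A\<close>, \<open>B\<close>, \<open>C\<close> order the two special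
  coordinates and all larger elements, in particular \<open>J\<close>; \<open>k + 4\<close> can be a value and an element of \<open>J\<close>
  at the same time.
\<close>

definition rank :: "nat \<Rightarrow> nat \<Rightarrow> nat \<Rightarrow> nat \<Rightarrow> nat \<Rightarrow> nat" where
  "rank k A B C i = (if i = k + 2 then A else if i = k + 3 then B else if i \<le> k + 1 then 0 else C)"

lemma admissible_typeI:
  assumes "J \<subseteq> {k + 4..n}" "card J = k + 1" "finite V" "card V = k + 1"
    and "x \<noteq> y" "x \<notin> V" "y \<notin> V" "insert x (insert y V) \<subseteq> {1..n}"
    and "rank k A B C x < A" "rank k A B C y < B" "\<And>v. v \<in> V \<Longrightarrow> rank k A B C v < C"
  shows "admissible_type n (k + 2) (k + 3) J (x, y, V)"
proof -
  have "rank k A B C j = C" if "j \<in> J" for j using that assms(1) by (auto simp: rank_def)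
  moreover have "rank k A B C (k + 2) = A" "rank k A B C (k + 3) = B" by (simp_all add: rank_def)
  ultimately have "\<exists>r :: nat \<Rightarrow> nat. r x < r (k + 2) \<and> r y < r (k + 3) \<and> (\<forall>j\<in>J. \<forall>v\<in>V. r v < r j)"
    using assms(9-11) by (intro exI[of _ "rank k A B C"]) simp
  then show ?thesis using assms(2-8) by (simp add: admissible_type_def)
qed

text \<open>
  The first four bounds come from distinct values. The last two conclusions, the absence of fixed
  points and of the 2-cycle between \<open>k + 2\<close> and \<open>k + 3\<close>, are stated as case distinctions: in each
  case the inequalities below are linear consequences of the bounds.
\<close>

lemma tour_bounds:
  assumes p: "p \<in> tours n" and n: "k + 7 \<le> n" and J: "J \<subseteq> {k + 4..n}" "card J = k + 1"
  defines "T \<equiv> \<Sum>{1..k + 1}" and "x \<equiv> p (k + 2)" and "y \<equiv> p (k + 3)" and "Q \<equiv> \<Sum>j\<in>J. p j"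
  shows "T \<le> Q" "T + k + 2 \<le> Q + x" "T + k + 2 \<le> Q + y" "T + 2 * k + 5 \<le> Q + x + y"
    "x \<le> k + 1 \<or> x = k + 3 \<and> y \<noteq> k + 2 \<or> k + 4 \<le> x"
    "y \<le> k + 1 \<or> y = k + 2 \<or> k + 4 \<le> y"
proof -
  have fin: "finite J" using J(1) finite_subset by blast
  have JN: "J \<subseteq> {1..n}" using J(1) by auto
  have notin: "k + 2 \<notin> J" "k + 3 \<notin> J" using J(1) by auto
  have tri: "\<Sum>{1..k + 2} = T + k + 2" "\<Sum>{1..k + 3} = T + 2 * k + 5"
    by (simp_all add: T_def numeral_eq_Suc)
  show "T \<le> Q" using tours_sum_ge[OF p JN] J(2) by (simp add: T_def Q_def)
  show "T + k + 2 \<le> Q + x"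
    using tours_sum_ge[OF p, of "insert (k + 2) J"] JN n fin notin J(2) tri by (simp add: x_def Q_def)
  show "T + k + 2 \<le> Q + y"
    using tours_sum_ge[OF p, of "insert (k + 3) J"] JN n fin notin J(2) tri by (simp add: y_def Q_def)
  show "T + 2 * k + 5 \<le> Q + x + y"
    using tours_sum_ge[OF p, of "insert (k + 2) (insert (k + 3) J)"] JN n fin notin J(2) tri
    by (simp add: x_def y_def Q_def)
  have "x \<noteq> k + 2" using tours_no_short_cycle[OF p, of "{k + 2}"] n by (auto simp: x_def)
  moreover have "y \<noteq> k + 2" if "x = k + 3"
    using tours_no_short_cycle[OF p, of "{k + 2, k + 3}"] n that by (auto simp: x_def y_def)
  ultimately show "x \<le> k + 1 \<or> x = k + 3 \<and> y \<noteq> k + 2 \<or> k + 4 \<le> x" by linarith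
  have "y \<noteq> k + 3" using tours_no_short_cycle[OF p, of "{k + 3}"] n by (auto simp: y_def)
  then show "y \<le> k + 1 \<or> y = k + 2 \<or> k + 4 \<le> y" by linarith
qed

context
  fixes e :: "nat \<Rightarrow> 'n::finite" and n k T :: nat and J :: "nat set"
  assumes n: "n = CARD('n)" "k + 7 \<le> n" and e: "bij_betw e {1..n} UNIV"
    and J: "J \<subseteq> {k + 4..n}" "card J = k + 1"
  defines "T \<equiv> \<Sum>{1..k + 1}"
begin

lemmas bounds = tour_bounds[OF _ n(2) J, folded T_def]
lemmas typeI = admissible_typeI[OF J]

lemma facet_of_three_types:
  fixes k1 k2 k3 b :: nat
  assumes "k3 > 0"
    and "\<And>p. p \<in> tours n \<Longrightarrow> b \<le> k1 * p (k + 2) + k2 * p (k + 3) + k3 * (\<Sum>j\<in>J. p j)"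
    and "admissible_type n (k + 2) (k + 3) J (xa, ya, Va)" "k1 * xa + k2 * ya + k3 * \<Sum>Va = b"
    and "admissible_type n (k + 2) (k + 3) J (xb, yb, Vb)" "k1 * xb + k2 * yb + k3 * \<Sum>Vb = b"
    and "admissible_type n (k + 2) (k + 3) J (xc, yc, Vc)" "k1 * xc + k2 * yc + k3 * \<Sum>Vc = b"
    and "\<And>(\<alpha>::real) (\<beta>::real) (\<gamma>::real) (c::real). \<alpha> * real xa + \<beta> * real ya + \<gamma> * real (\<Sum>Va) = c \<Longrightarrow>
        \<alpha> * real xb + \<beta> * real yb + \<gamma> * real (\<Sum>Vb) = c \<Longrightarrow>
        \<alpha> * real xc + \<beta> * real yc + \<gamma> * real (\<Sum>Vc) = c \<Longrightarrow>
        \<exists>l. \<alpha> = l * real k1 \<and> \<beta> = l * real k2 \<and> \<gamma> = l * real k3"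
  shows "facet_defining (circuit_polytope e)
           (\<lambda>x. k1 * x $ e (k + 2) + k2 * x $ e (k + 3) + k3 * (\<Sum>j\<in>J. x $ e j)) b"
proof (rule facet_defining_of_types[where T = "{(xa, ya, Va), (xb, yb, Vb), (xc, yc, Vc)}", OF n(1) e])
  show "insert (k + 2) (insert (k + 3) J) \<subseteq> {1..n}" "k + 2 \<notin> J" "k + 3 \<notin> J"
    using n(2) J(1) by auto
  show "J \<noteq> {}" "card J + 6 \<le> n" using n(2) J(2) by auto
qed (use assms in auto)

text \<open>
  The sums over the value sets \<open>V\<close> of the tight types, relative to \<open>T = 1 + \<dots> + (k + 1)\<close>.
\<close>

lemma sums_with_gap:
  "\<Sum>(insert (k + 2) {1..k}) = T + 1" "\<Sum>(insert (k + 3) {1..k}) = T + 2"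
  by (simp_all add: T_def)

lemma sums_from_two:
  assumes "1 \<le> k"
  shows "\<Sum>{3..k + 3} = T + 2 * k + 2" "\<Sum>{2..k + 2} = T + k + 1"
    "\<Sum>(insert (k + 3) {2..k + 1}) = T + k + 2"
    "\<Sum>(insert (k + 3) (insert 1 {3..k + 1})) = T + k + 1"
proof -
  have 1: "\<Sum>{1..j} = 1 + \<Sum>{2..j}" if "1 \<le> j" for j :: nat
    using sum.atLeast_Suc_atMost[of 1 j "\<lambda>x. x"] that by (simp add: numeral_2_eq_2)
  have 2: "\<Sum>{2..j} = 2 + \<Sum>{3..j}" if "2 \<le> j" for j :: nat
    using sum.atLeast_Suc_atMost[of 2 j "\<lambda>x. x"] that by (simp add: numeral_3_eq_3)
  have 3: "\<Sum>{1..k + 2} = T + k + 2" "\<Sum>{1..k + 3} = T + 2 * k + 5"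
    by (simp_all add: T_def numeral_eq_Suc)
  show "\<Sum>{3..k + 3} = T + 2 * k + 2" using 1[of "k + 3"] 2[of "k + 3"] 3 by simp
  show "\<Sum>{2..k + 2} = T + k + 1" using 1[of "k + 2"] 3 by simp
  show "\<Sum>(insert (k + 3) {2..k + 1}) = T + k + 2" using 1[of "k + 1"] by (simp add: T_def)
  show "\<Sum>(insert (k + 3) (insert 1 {3..k + 1})) = T + k + 1"
    using 1[of "k + 1"] 2[of "k + 1"] assms by (simp add: T_def)
qed

text \<open>
  The bound of the first inequality is the minimum over all permutations. For the other four that
  minimum is attained only with a fixed point, and the bound is the least value left when fixed
  points and the 2-cycle are excluded. The three types in each proof attain the bound, and the
  differences of their equations determine the coefficients up to a factor.
\<close>

lemma facet_1_1_1:
  assumes k: "1 \<le> k"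
  shows "facet_defining (circuit_polytope e)
    (\<lambda>x. real 1 * x $ e (k + 2) + real 1 * x $ e (k + 3) + real 1 * (\<Sum>j\<in>J. x $ e j))
    (real (T + 2 * k + 5))"
proof (rule facet_of_three_types[where xa = "1" and ya = "2" and Va = "{3..k + 3}"
    and xb = "2" and yb = "1" and Vb = "{3..k + 3}"
    and xc = "1" and yc = "k + 2" and Vc = "insert (k + 3) {2..k + 1}"])
  fix p assume p: "p \<in> tours n"
  show "T + 2 * k + 5 \<le> 1 * p (k + 2) + 1 * p (k + 3) + 1 * (\<Sum>j\<in>J. p j)"
    using bounds[OF p] by (elim disjE conjE; linarith)
next
  show "admissible_type n (k + 2) (k + 3) J (1, 2, {3..k + 3})"
    by (rule typeI[where A = 1 and B = 1 and C = 2]) (use n k in \<open>auto simp: rank_def\<close>)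
  show "admissible_type n (k + 2) (k + 3) J (2, 1, {3..k + 3})"
    by (rule typeI[where A = 1 and B = 1 and C = 2]) (use n k in \<open>auto simp: rank_def\<close>)
  show "admissible_type n (k + 2) (k + 3) J (1, k + 2, insert (k + 3) {2..k + 1})"
    by (rule typeI[where A = 1 and B = 2 and C = 3]) (use n k in \<open>auto simp: rank_def\<close>)
next
  fix \<alpha> \<beta> \<gamma> c :: real
  assume h: "\<alpha> * real 1 + \<beta> * real 2 + \<gamma> * real (\<Sum>{3..k + 3}) = c"
    "\<alpha> * real 2 + \<beta> * real 1 + \<gamma> * real (\<Sum>{3..k + 3}) = c"
    "\<alpha> * real 1 + \<beta> * real (k + 2) + \<gamma> * real (\<Sum>(insert (k + 3) {2..k + 1})) = c"
  have "\<alpha> = \<beta>" using h(1,2) by simp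
  moreover have "\<alpha> + 2 * \<beta> + (\<gamma> * real T + 2 * (\<gamma> * real k) + 2 * \<gamma>) = c"
    "\<alpha> + (\<beta> * real k + 2 * \<beta>) + (\<gamma> * real T + \<gamma> * real k + 2 * \<gamma>) = c"
    using h(1,3) unfolding sums_from_two[OF k] by (simp_all add: algebra_simps)
  then have "\<gamma> * real k - \<beta> * real k = 0" by linarith
  then have "(\<gamma> - \<beta>) * real k = 0" by (simp only: left_diff_distrib)
  ultimately show "\<exists>l. \<alpha> = l * real 1 \<and> \<beta> = l * real 1 \<and> \<gamma> = l * real 1"
    using k by simp
qed (simp_all only: sums_from_two[OF k], simp_all)

lemma facet_2_1_2:
  assumes k: "1 \<le> k"
  shows "facet_defining (circuit_polytope e)
    (\<lambda>x. real 2 * x $ e (k + 2) + real 1 * x $ e (k + 3) + real 2 * (\<Sum>j\<in>J. x $ e j))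
    (real (2 * T + 3 * k + 8))"
proof (rule facet_of_three_types[where xa = "1" and ya = "k + 2" and Va = "insert (k + 3) {2..k + 1}"
    and xb = "2" and yb = "k + 2" and Vb = "insert (k + 3) (insert 1 {3..k + 1})"
    and xc = "1" and yc = "k + 4" and Vc = "{2..k + 2}"])
  fix p assume p: "p \<in> tours n"
  show "2 * T + 3 * k + 8 \<le> 2 * p (k + 2) + 1 * p (k + 3) + 2 * (\<Sum>j\<in>J. p j)"
    using bounds[OF p] by (elim disjE conjE; linarith)
next
  show "admissible_type n (k + 2) (k + 3) J (1, k + 2, insert (k + 3) {2..k + 1})"
    by (rule typeI[where A = 1 and B = 2 and C = 3]) (use n k in \<open>auto simp: rank_def\<close>)
  show "admissible_type n (k + 2) (k + 3) J (2, k + 2, insert (k + 3) (insert 1 {3..k + 1}))"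
    by (rule typeI[where A = 1 and B = 2 and C = 3]) (use n k in \<open>auto simp: rank_def\<close>)
  show "admissible_type n (k + 2) (k + 3) J (1, k + 4, {2..k + 2})"
    by (rule typeI[where A = 1 and B = 3 and C = 2]) (use n k in \<open>auto simp: rank_def\<close>)
next
  fix \<alpha> \<beta> \<gamma> c :: real
  assume h: "\<alpha> * real 1 + \<beta> * real (k + 2) + \<gamma> * real (\<Sum>(insert (k + 3) {2..k + 1})) = c"
    "\<alpha> * real 2 + \<beta> * real (k + 2) + \<gamma> * real (\<Sum>(insert (k + 3) (insert 1 {3..k + 1}))) = c"
    "\<alpha> * real 1 + \<beta> * real (k + 4) + \<gamma> * real (\<Sum>{2..k + 2}) = c"
  have "\<alpha> = \<gamma>" "\<gamma> = \<beta> * 2" using h unfolding sums_from_two[OF k] by (simp_all add: algebra_simps)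
  then show "\<exists>l. \<alpha> = l * real 2 \<and> \<beta> = l * real 1 \<and> \<gamma> = l * real 2"
    by (intro exI[of _ \<beta>]) simp
qed (simp_all only: sums_from_two[OF k], simp_all)

lemma facet_2_1_4:
  "facet_defining (circuit_polytope e)
    (\<lambda>x. real 2 * x $ e (k + 2) + real 1 * x $ e (k + 3) + real 4 * (\<Sum>j\<in>J. x $ e j))
    (real (4 * T + 3 * k + 10))"
proof (rule facet_of_three_types[where xa = "k + 3" and ya = "k + 4" and Va = "{1..k + 1}"
    and xb = "k + 4" and yb = "k + 2" and Vb = "{1..k + 1}"
    and xc = "k + 1" and yc = "k + 4" and Vc = "insert (k + 2) {1..k}"])
  fix p assume p: "p \<in> tours n"
  show "4 * T + 3 * k + 10 \<le> 2 * p (k + 2) + 1 * p (k + 3) + 4 * (\<Sum>j\<in>J. p j)"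
    using bounds[OF p] by (elim disjE conjE; linarith)
next
  show "admissible_type n (k + 2) (k + 3) J (k + 3, k + 4, {1..k + 1})"
    by (rule typeI[where A = 3 and B = 2 and C = 1]) (use n in \<open>auto simp: rank_def\<close>)
  show "admissible_type n (k + 2) (k + 3) J (k + 4, k + 2, {1..k + 1})"
    by (rule typeI[where A = 2 and B = 3 and C = 1]) (use n in \<open>auto simp: rank_def\<close>)
  show "admissible_type n (k + 2) (k + 3) J (k + 1, k + 4, insert (k + 2) {1..k})"
    by (rule typeI[where A = 1 and B = 3 and C = 2]) (use n in \<open>auto simp: rank_def\<close>)
next
  fix \<alpha> \<beta> \<gamma> c :: real
  assume h: "\<alpha> * real (k + 3) + \<beta> * real (k + 4) + \<gamma> * real (\<Sum>{1..k + 1}) = c"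
    "\<alpha> * real (k + 4) + \<beta> * real (k + 2) + \<gamma> * real (\<Sum>{1..k + 1}) = c"
    "\<alpha> * real (k + 1) + \<beta> * real (k + 4) + \<gamma> * real (\<Sum>(insert (k + 2) {1..k})) = c"
  have "\<alpha> = \<beta> * 2" "\<gamma> = \<alpha> * 2"
    using h unfolding sums_with_gap T_def[symmetric] by (simp_all add: algebra_simps)
  then show "\<exists>l. \<alpha> = l * real 2 \<and> \<beta> = l * real 1 \<and> \<gamma> = l * real 4"
    by (intro exI[of _ \<beta>]) simp
qed (simp_all only: sums_with_gap T_def[symmetric], simp_all)

lemma facet_3_2_4:
  "facet_defining (circuit_polytope e)
    (\<lambda>x. real 3 * x $ e (k + 2) + real 2 * x $ e (k + 3) + real 4 * (\<Sum>j\<in>J. x $ e j))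
    (real (4 * T + 5 * k + 15))"
proof (rule facet_of_three_types[where xa = "k + 1" and ya = "k + 2" and Va = "insert (k + 3) {1..k}"
    and xb = "k + 3" and yb = "k + 1" and Vb = "insert (k + 2) {1..k}"
    and xc = "k + 1" and yc = "k + 4" and Vc = "insert (k + 2) {1..k}"])
  fix p assume p: "p \<in> tours n"
  show "4 * T + 5 * k + 15 \<le> 3 * p (k + 2) + 2 * p (k + 3) + 4 * (\<Sum>j\<in>J. p j)"
    using bounds[OF p] by (elim disjE conjE; linarith)
next
  show "admissible_type n (k + 2) (k + 3) J (k + 1, k + 2, insert (k + 3) {1..k})"
    by (rule typeI[where A = 1 and B = 2 and C = 3]) (use n in \<open>auto simp: rank_def\<close>)
  show "admissible_type n (k + 2) (k + 3) J (k + 3, k + 1, insert (k + 2) {1..k})"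
    by (rule typeI[where A = 2 and B = 1 and C = 3]) (use n in \<open>auto simp: rank_def\<close>)
  show "admissible_type n (k + 2) (k + 3) J (k + 1, k + 4, insert (k + 2) {1..k})"
    by (rule typeI[where A = 1 and B = 3 and C = 2]) (use n in \<open>auto simp: rank_def\<close>)
next
  fix \<alpha> \<beta> \<gamma> c :: real
  assume h: "\<alpha> * real (k + 1) + \<beta> * real (k + 2) + \<gamma> * real (\<Sum>(insert (k + 3) {1..k})) = c"
    "\<alpha> * real (k + 3) + \<beta> * real (k + 1) + \<gamma> * real (\<Sum>(insert (k + 2) {1..k})) = c"
    "\<alpha> * real (k + 1) + \<beta> * real (k + 4) + \<gamma> * real (\<Sum>(insert (k + 2) {1..k})) = c"
  have "\<gamma> = \<beta> * 2" "\<alpha> * 2 = \<beta> * 3"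
    using h unfolding sums_with_gap by (simp_all add: algebra_simps)
  then show "\<exists>l. \<alpha> = l * real 3 \<and> \<beta> = l * real 2 \<and> \<gamma> = l * real 4"
    by (intro exI[of _ "\<beta> / 2"]) simp
qed (simp_all only: sums_with_gap, simp_all)

lemma facet_3_2_5:
  "facet_defining (circuit_polytope e)
    (\<lambda>x. real 3 * x $ e (k + 2) + real 2 * x $ e (k + 3) + real 5 * (\<Sum>j\<in>J. x $ e j))
    (real (5 * T + 5 * k + 16))"
proof (rule facet_of_three_types[where xa = "k + 4" and ya = "k + 2" and Va = "{1..k + 1}"
    and xb = "k + 1" and yb = "k + 4" and Vb = "insert (k + 2) {1..k}"
    and xc = "k + 3" and yc = "k + 1" and Vc = "insert (k + 2) {1..k}"])
  fix p assume p: "p \<in> tours n"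
  show "5 * T + 5 * k + 16 \<le> 3 * p (k + 2) + 2 * p (k + 3) + 5 * (\<Sum>j\<in>J. p j)"
    using bounds[OF p] by (elim disjE conjE; linarith)
next
  show "admissible_type n (k + 2) (k + 3) J (k + 4, k + 2, {1..k + 1})"
    by (rule typeI[where A = 2 and B = 3 and C = 1]) (use n in \<open>auto simp: rank_def\<close>)
  show "admissible_type n (k + 2) (k + 3) J (k + 1, k + 4, insert (k + 2) {1..k})"
    by (rule typeI[where A = 1 and B = 3 and C = 2]) (use n in \<open>auto simp: rank_def\<close>)
  show "admissible_type n (k + 2) (k + 3) J (k + 3, k + 1, insert (k + 2) {1..k})"
    by (rule typeI[where A = 2 and B = 1 and C = 3]) (use n in \<open>auto simp: rank_def\<close>)
next
  fix \<alpha> \<beta> \<gamma> c :: real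
  assume h: "\<alpha> * real (k + 4) + \<beta> * real (k + 2) + \<gamma> * real (\<Sum>{1..k + 1}) = c"
    "\<alpha> * real (k + 1) + \<beta> * real (k + 4) + \<gamma> * real (\<Sum>(insert (k + 2) {1..k})) = c"
    "\<alpha> * real (k + 3) + \<beta> * real (k + 1) + \<gamma> * real (\<Sum>(insert (k + 2) {1..k})) = c"
  have "\<alpha> * 2 = \<beta> * 3" "\<gamma> = \<alpha> * 3 - \<beta> * 2"
    using h unfolding sums_with_gap T_def[symmetric] by (simp_all add: algebra_simps)
  then show "\<exists>l. \<alpha> = l * real 3 \<and> \<beta> = l * real 2 \<and> \<gamma> = l * real 5"
    by (intro exI[of _ "\<beta> / 2"]) simp
qed (simp_all only: sums_with_gap T_def[symmetric], simp_all)

end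

section \<open>The facets of the hamiltonian circuit polytope\<close>

theorem theorem15:
  fixes e :: "nat \<Rightarrow> 'n::finite" and n m :: nat and J :: "nat set"
  assumes n: "n = CARD('n)"
    and e: "bij_betw e {1..n} UNIV"
    and m: "m > 0" "m + 4 \<le> n"
    and J: "J \<subseteq> {m+1..n}" "card J = m - 2"
  shows
    "(4 \<le> m \<and> int m \<le> \<lceil>(real n + 1) / 2\<rceil> \<longrightarrow>
        facet_defining (circuit_polytope e)
          (\<lambda>x. x $ e (m - 1) + x $ e m + (\<Sum>j\<in>J. x $ e j))
          (1 / 2 * real m * (real m + 1))) \<and>
     (4 \<le> m \<and> int m \<le> \<lceil>(real n + 1) / 2\<rceil> \<longrightarrow>
        facet_defining (circuit_polytope e)
          (\<lambda>x. 2 * x $ e (m - 1) + x $ e m + 2 * (\<Sum>j\<in>J. x $ e j))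
          ((real m)^2 + 1)) \<and>
     (3 \<le> m \<and> int m \<le> \<lceil>(real n + 1) / 2\<rceil> \<longrightarrow>
        facet_defining (circuit_polytope e)
          (\<lambda>x. 2 * x $ e (m - 1) + x $ e m + 4 * (\<Sum>j\<in>J. x $ e j))
          (real m * (2 * real m - 3) + 5)) \<and>
     (3 \<le> m \<and> int m \<le> \<lceil>(real n + 1) / 2\<rceil> \<longrightarrow>
        facet_defining (circuit_polytope e)
          (\<lambda>x. 3 * x $ e (m - 1) + 2 * x $ e m + 4 * (\<Sum>j\<in>J. x $ e j))
          (real m * (2 * real m - 1) + 4)) \<and>
     (3 \<le> m \<and> int m \<le> \<lceil>(real n + 1) / 2\<rceil> \<longrightarrow>
        facet_defining (circuit_polytope e)
          (\<lambda>x. 3 * x $ e (m - 1) + 2 * x $ e m + 5 * (\<Sum>j\<in>J. x $ e j))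
          (5 / 2 * real m * (real m - 1) + 6))"
proof (cases "3 \<le> m")
  case True
  then obtain k where k: "m = k + 3" using le_Suc_ex by (metis add.commute)
  have nk: "k + 7 \<le> n" and Jk: "J \<subseteq> {k + 4..n}" "card J = k + 1"
    using m J by (auto simp: k)
  define T where "T = \<Sum>{1..k + 1}"
  have "2 * T = (k + 1) * (k + 2)"
    using double_gauss_sum_from_Suc_0[of "k + 1", where ?'a = nat] by (simp add: T_def)
  then have "2 * real T = (real k + 1) * (real k + 2)"
    by (metis of_nat_1 of_nat_add of_nat_mult of_nat_numeral)
  then have T: "real T = (real k + 1) * (real k + 2) / 2" by simp
  note facts = n nk e Jk
  have m1: "m - 1 = k + 2" by (simp add: k)
  have b: "real (T + 2 * k + 5) = 1 / 2 * real m * (real m + 1)"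
    "real (2 * T + 3 * k + 8) = (real m)^2 + 1"
    "real (4 * T + 3 * k + 10) = real m * (2 * real m - 3) + 5"
    "real (4 * T + 5 * k + 15) = real m * (2 * real m - 1) + 4"
    "real (5 * T + 5 * k + 16) = 5 / 2 * real m * (real m - 1) + 6"
    using T by (simp_all add: k field_simps power2_eq_square)
  have le: "4 \<le> m \<Longrightarrow> 1 \<le> k" by (simp add: k)
  show ?thesis
    using facet_1_1_1[OF facts le, folded T_def] facet_2_1_2[OF facts le, folded T_def]
      facet_2_1_4[OF facts, folded T_def] facet_3_2_4[OF facts, folded T_def]
      facet_3_2_5[OF facts, folded T_def]
    unfolding b m1[symmetric] k[symmetric] of_nat_1 of_nat_numeral mult_1 by blast
qed simp

end
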